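(* Let $(X,d)$ be a compact and connected metric space satisfying: (P1) there exists $r>0$ such that the open ball $B(x,r')$ is connected for every $r'\in(0,r)$ and every $x\in X$; and (P2) the map $(x,s)\mapsto\overline{B(x,s)}$ ($x\in X$, $s>0$) is continuous in the Hausdorff topology. Then every continuum-wise expansive homeomorphism $f\colon X\to X$ is first-time sensitive.
   Context: A continuum is a compact connected set; it is non-trivial if it is not a singleton. A homeomorphism $f$ of a compact metric space $X$ is continuum-wise expansive (cw-expansive) if there is $c>0$ such that for each non-trivial continuum $C\subset X$ there exists $n\in\mathbb Z$ with $\operatorname{diam}(f^n(C))>c$. A map $f\colon X\to X$ is sensitive if there is $\varepsilon>0$ (a sensitivity constant) such that for every $x\in X$ and every $\delta>0$ there exist $y\in X$ with $d(x,y)<\delta$ and $n\in\mathbb N$ with $d(f^n(x),f^n(y))>\varepsilon$. Any $\gamma\in(0,\varepsilon]$ is then also a sensitivity constant. For a sensitive homeomorphism and a sensitivity constant $\gamma$, the first increasing time $n_1(x,r,\gamma)$ is the first iterate $n\ge 0$ with $\operatorname{diam} f^{n}(B(x,r))>\gamma$. A sensitive homeomorphism $f$ with sensitivity constant $\varepsilon$ is first-time sensitive if there is a sequence of functions $r_k\colon X\to(0,\infty)$, $k\in\mathbb N=\{1,2,\dots\}$, with $r_1$ constant and $(r_k(x))_k$ decreasing monotonically to $0$ for each $x$, such that for each $\gamma\in(0,\varepsilon]$ there is $m_\gamma>0$ satisfying (F1) $|n_1(x,r_{k+1}(x),\gamma)-n_1(x,r_k(x),\gamma)|\leq m_\gamma$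 and (F2) $|n_1(x,r_k(x),\gamma)-n_1(x,r_k(x),\varepsilon)|\leq m_\gamma$ for every $x\in X$ and every $k\in\mathbb N$ with $r_k(x)\leq\gamma$.
   Formalization: The space X is additionally assumed not to be a single point: on a one-point space every homeomorphism is vacuously continuum-wise expansive and (P1), (P2) hold, but no map is sensitive, so the claim fails there. *)

theory Defs
  imports "HOL-Analysis.Analysis"
begin

text \<open>
  The ambient space \<open>X\<close> is the whole type \<^typ>\<open>'a\<close> of class \<^class>\<open>metric_space\<close>; its compactness
  and connectedness are hypotheses on \<^term>\<open>UNIV :: 'a set\<close>.
\<close>

definition homeo :: "('a::metric_space \<Rightarrow> 'a) \<Rightarrow> bool" where
  "homeo f \<longleftrightarrow> (\<exists>g. homeomorphism UNIV UNIV f g)"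

text \<open>Integer iterates; only meaningful when \<open>f\<close> is a bijection.\<close>

definition int_iter :: "('a \<Rightarrow> 'a) \<Rightarrow> int \<Rightarrow> 'a \<Rightarrow> 'a" where
  "int_iter f n = (if n \<ge> 0 then f ^^ nat n else inv f ^^ nat (- n))"

text \<open>The library's \<^const>\<open>connected\<close> holds of the empty set, which is not a continuum.\<close>

definition nontrivial_continuum :: "'a::metric_space set \<Rightarrow> bool" where
  "nontrivial_continuum C \<longleftrightarrow> compact C \<and> connected C \<and> C \<noteq> {} \<and> (\<nexists>x. C = {x})"

definition cw_expansive :: "('a::metric_space \<Rightarrow> 'a) \<Rightarrow> bool" where
  "cw_expansive f \<longleftrightarrow> homeo f \<and>
     (\<exists>c>0. \<forall>C. nontrivial_continuum C \<longrightarrow> (\<exists>n::int. diameter (int_iter f n ` C) > c))"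

text \<open>
  Here the natural numbers start at \<open>1\<close>. In the definition of sensitivity this makes no
  difference, since \<open>\<delta>\<close> may be taken smaller than \<open>\<epsilon>\<close>.
\<close>

definition sensitivity_constant :: "('a::metric_space \<Rightarrow> 'a) \<Rightarrow> real \<Rightarrow> bool" where
  "sensitivity_constant f \<epsilon> \<longleftrightarrow> \<epsilon> > 0 \<and>
     (\<forall>x. \<forall>\<delta>>0. \<exists>y. dist x y < \<delta> \<and> (\<exists>n\<ge>1. dist ((f ^^ n) x) ((f ^^ n) y) > \<epsilon>))"

text \<open>
  The first increasing time. If \<open>\<gamma>\<close> is a sensitivity constant and \<open>r > 0\<close>, an iterate as required
  exists (on a bounded space), so \<^const>\<open>Least\<close> is then well-defined.
\<close>

definition first_incr_time :: "('a::metric_space \<Rightarrow> 'a) \<Rightarrow> 'a \<Rightarrow> real \<Rightarrow> real \<Rightarrow> nat" where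
  "first_incr_time f x r \<gamma> = (LEAST n. diameter ((f ^^ n) ` ball x r) > \<gamma>)"

text \<open>The value of \<open>r\<close> at index \<open>0\<close> is irrelevant: the sequence is indexed by \<open>k \<ge> 1\<close>.\<close>

definition first_time_sensitive :: "('a::metric_space \<Rightarrow> 'a) \<Rightarrow> bool" where
  "first_time_sensitive f \<longleftrightarrow> homeo f \<and>
     (\<exists>\<epsilon>. sensitivity_constant f \<epsilon> \<and>
       (\<exists>r :: nat \<Rightarrow> 'a \<Rightarrow> real.
          (\<forall>k\<ge>1. \<forall>x. r k x > 0) \<and>
          (\<exists>r1. \<forall>x. r 1 x = r1) \<and>
          (\<forall>x. (\<forall>k\<ge>1. r (Suc k) x < r k x) \<and> (\<lambda>k. r k x) \<longlonglongrightarrow> 0) \<and>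
          (\<forall>\<gamma>. 0 < \<gamma> \<and> \<gamma> \<le> \<epsilon> \<longrightarrow>
             (\<exists>m::real. m > 0 \<and>
                (\<forall>x. \<forall>k\<ge>1. r k x \<le> \<gamma> \<longrightarrow>
                   \<bar>real (first_incr_time f x (r (Suc k) x) \<gamma>)
                      - real (first_incr_time f x (r k x) \<gamma>)\<bar> \<le> m \<and>
                   \<bar>real (first_incr_time f x (r k x) \<gamma>)
                      - real (first_incr_time f x (r k x) \<epsilon>)\<bar> \<le> m)))))"

text \<open>The Hausdorff distance; a metric on the nonempty compact sets.\<close>

definition hausdorff_dist :: "'a::metric_space set \<Rightarrow> 'a set \<Rightarrow> real" where
  "hausdorff_dist A B = max (SUP a\<in>A. infdist a B) (SUP b\<in>B. infdist b A)"

definition small_balls_connected :: "'a::metric_space itself \<Rightarrow> bool" where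
  "small_balls_connected _ \<longleftrightarrow>
     (\<exists>r>0. \<forall>r'. 0 < r' \<and> r' < r \<longrightarrow> (\<forall>x::'a. connected (ball x r')))"

definition closed_balls_continuous :: "'a::metric_space itself \<Rightarrow> bool" where
  "closed_balls_continuous _ \<longleftrightarrow>
     (\<forall>(x::'a) s. s > 0 \<longrightarrow>
        ((\<lambda>(y, t). hausdorff_dist (closure (ball y t)) (closure (ball x s))) \<longlongrightarrow> 0)
          (at (x, s) within UNIV \<times> {0<..}))"

end

theory Submission
  imports Defs "HOL-Complex_Analysis.Great_Picard"
begin

text \<open>
  The proof rests on a uniform form of cw-expansivity (\<open>uniform_expansive\<close>): a connected set of
  diameter at least \<open>\<eta>\<close> exceeds the expansivity constant \<open>c\<close> at some time within \<open>N(\<eta>)\<close> steps, past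
  or future. It follows from the compactness of the hyperspace of continua
  (\<open>connected_sets_subconverge\<close>).

  Continuity of closed balls makes the diameter of \<open>f ^^ n\<close> of a ball depend continuously on the
  radius. A ball can therefore be shrunk until its maximal size over finitely many times is
  exactly a prescribed \<open>e\<close> (\<open>critical_radius\<close>). If \<open>e\<close> is at most \<open>c\<close>, then the nearby time at which this
  ball exceeds \<open>c\<close> lies outside that set of times. The consequences are the following.

  \<^item> A tiny ball that has once exceeded \<open>c\<close> never becomes tiny again (\<open>large_balls_stay_large\<close>).
    Consequently no ball is stable: preimages of a stable ball would contain arbitrarily many
    disjoint pieces of a fixed size (\<open>no_stable_ball\<close>). This is sensitivity with constant
    \<open>\<epsilon> = c / 2\<close>, and by compactness the growth time of balls of a given radius is bounded uniformly
    in the centre (\<open>uniform_sensitivity_time\<close>).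

  \<^item> For every large \<open>n\<close> and every \<open>x\<close> there is a radius whose first increasing time for \<open>\<epsilon>\<close> is in
    \<open>{n<..n + N}\<close> (\<open>critical_radii_with_linear_times\<close>). Taking \<open>n\<close> along an arithmetic progression of
    step \<open>N + 1\<close> yields the functions \<open>r\<^sub>k\<close>, with times that grow by bounded amounts.

  \<^item> The times at which a ball first exceeds \<open>\<gamma>\<close> and first exceeds \<open>\<epsilon>\<close> differ by a bound depending on
    \<open>\<gamma>\<close> (\<open>bounded_delay\<close>). Together with the bounded steps of the times for \<open>\<epsilon>\<close> this
    bounds the steps of the times for \<open>\<gamma>\<close>.
\<close>

lemma diameter_gt_iff:
  fixes S :: "'a::metric_space set"
  assumes "compact (UNIV :: 'a set)" "0 \<le> e"
  shows "diameter S > e \<longleftrightarrow> (\<exists>x\<in>S. \<exists>y\<in>S. dist x y > e)"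
proof -
  have b: "bounded S"
    using compact_imp_bounded[OF assms(1)] bounded_subset by blast
  show ?thesis
  proof
    assume g: "diameter S > e"
    define d where "d = (e + diameter S) / 2"
    have "0 < d" "d < diameter S" "e < d"
      using g assms(2) by (auto simp: d_def)
    then show "\<exists>x\<in>S. \<exists>y\<in>S. dist x y > e"
      using diameter_bounded(2)[OF b] by (meson less_trans)
  next
    assume "\<exists>x\<in>S. \<exists>y\<in>S. dist x y > e"
    then show "diameter S > e"
      using diameter_bounded_bound[OF b] by (meson less_le_trans)
  qed
qed

section \<open>Limits of connected sets\<close>

text \<open>
  Convergence in the sense of Kuratowski; on the nonempty closed subsets of a compact space it is
  convergence in the Hausdorff metric. The \<open>C n\<close> need not be closed, which allows open balls.
\<close>

definition kuratowski_limit :: "(nat \<Rightarrow> 'a::metric_space set) \<Rightarrow> 'a set \<Rightarrow> bool" where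
  "kuratowski_limit C K \<longleftrightarrow> (\<forall>p\<in>K. (\<lambda>n. infdist p (C n)) \<longlonglongrightarrow> 0) \<and>
     (\<forall>(\<tau> :: nat \<Rightarrow> nat) p q. strict_mono \<tau> \<longrightarrow> (\<forall>j. p j \<in> C (\<tau> j)) \<longrightarrow> p \<longlonglongrightarrow> q \<longrightarrow> q \<in> K)"

text \<open>
  This is the compactness of the hyperspace of continua. A set is recorded by its distance function
  \<open>\<lambda>p. infdist p (C n)\<close>. These functions are \<open>1\<close>-Lipschitz, so a diagonal subsequence that converges
  on a countable dense set converges everywhere, and \<open>K\<close> is the zero set of the limit \<open>g\<close>. If \<open>K\<close>
  split into two closed pieces, the sets \<open>C (\<sigma> k)\<close> would eventually meet disjoint neighbourhoods of
  both, hence by connectedness contain points outside the two neighbourhoods; these accumulate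
  at a point of \<open>K\<close> that is in neither piece.
\<close>

lemma connected_sets_subconverge:
  fixes C :: "nat \<Rightarrow> 'a::metric_space set"
  assumes compact_space: "compact (UNIV :: 'a set)"
    and ne: "\<And>n. C n \<noteq> {}" and conn: "\<And>n. connected (C n)"
  shows "\<exists>\<sigma> K. strict_mono \<sigma> \<and> compact K \<and> connected K \<and> kuratowski_limit (C \<circ> \<sigma>) K"
proof -
  have seqc: "\<exists>l. \<exists>\<rho>::nat \<Rightarrow> nat. strict_mono \<rho> \<and> (p \<circ> \<rho>) \<longlonglongrightarrow> l" for p :: "nat \<Rightarrow> 'a"
    using compact_space by (metis UNIV_I compact_def)
  have "\<forall>n. \<exists>T::'a set. finite T \<and> UNIV \<subseteq> (\<Union>x\<in>T. ball x (inverse (real (Suc n))))"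
    using compact_eq_totally_bounded[of "UNIV :: 'a set"] compact_space
    by (metis inverse_positive_iff_positive of_nat_0_less_iff zero_less_Suc)
  then obtain T :: "nat \<Rightarrow> 'a set" where fin: "\<And>n. finite (T n)"
    and net: "\<And>n. UNIV \<subseteq> (\<Union>x\<in>T n. ball x (inverse (real (Suc n))))"
    by metis
  define D where "D = (\<Union>n. T n)"
  have "countable D"
    unfolding D_def using fin by (simp add: countable_finite)
  moreover have "norm (infdist p (C n)) \<le> diameter (UNIV :: 'a set)" for n p
  proof -
    obtain q where "q \<in> C n" using ne by blast
    then have "infdist p (C n) \<le> dist p q" by (rule infdist_le)
    also have "\<dots> \<le> diameter (UNIV :: 'a set)"
      using diameter_bounded_bound compact_imp_bounded compact_space by blast
    finally show ?thesis by (simp add: infdist_nonneg)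
  qed
  ultimately obtain \<sigma> :: "nat \<Rightarrow> nat" where \<sigma>: "strict_mono \<sigma>"
    and conv: "\<And>x. x \<in> D \<Longrightarrow> \<exists>l. (\<lambda>k. infdist x (C (\<sigma> k))) \<longlonglongrightarrow> l"
    using function_convergent_subsequence[of D "\<lambda>n p. infdist p (C n)"] by metis
  have lip: "\<bar>infdist p A - infdist q A\<bar> \<le> dist p q" for p q :: 'a and A
    using infdist_triangle_abs by blast
  have "Cauchy (\<lambda>k. infdist p (C (\<sigma> k)))" for p
  proof (rule metric_CauchyI)
    fix e :: real assume "0 < e"
    then obtain n where n: "inverse (real (Suc n)) < e / 3"
      using reals_Archimedean[of "e/3"] by auto
    obtain x where "x \<in> T n" "dist x p < inverse (real (Suc n))"
      using subsetD[OF net[of n] UNIV_I[of p]] by auto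
    then have x: "x \<in> D" "dist p x < e / 3"
      using n by (auto simp: D_def dist_commute)
    have "Cauchy (\<lambda>k. infdist x (C (\<sigma> k)))"
      using conv[OF x(1)] LIMSEQ_imp_Cauchy by blast
    then obtain M where M: "\<And>m n. m \<ge> M \<Longrightarrow> n \<ge> M \<Longrightarrow>
        dist (infdist x (C (\<sigma> m))) (infdist x (C (\<sigma> n))) < e / 3"
      using \<open>0 < e\<close> unfolding Cauchy_def by (metis divide_pos_pos zero_less_numeral)
    show "\<exists>M. \<forall>m\<ge>M. \<forall>n\<ge>M. dist (infdist p (C (\<sigma> m))) (infdist p (C (\<sigma> n))) < e"
    proof (intro exI allI impI)
      fix m n assume "m \<ge> M" "n \<ge> M"
      then show "dist (infdist p (C (\<sigma> m))) (infdist p (C (\<sigma> n))) < e"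
        using M[of m n] lip[of p "C (\<sigma> m)" x] lip[of p "C (\<sigma> n)" x] x(2)
        unfolding dist_real_def by linarith
    qed
  qed
  then have "\<forall>p. \<exists>l. (\<lambda>k. infdist p (C (\<sigma> k))) \<longlonglongrightarrow> l"
    using Cauchy_convergent convergent_def by blast
  then obtain g where g: "\<And>p. (\<lambda>k. infdist p (C (\<sigma> k))) \<longlonglongrightarrow> g p" by metis
  define K where "K = {p. g p = 0}"
  have glip: "\<bar>g p - g q\<bar> \<le> dist p q" for p q
  proof (rule LIMSEQ_le_const2)
    show "(\<lambda>k. \<bar>infdist p (C (\<sigma> k)) - infdist q (C (\<sigma> k))\<bar>) \<longlonglongrightarrow> \<bar>g p - g q\<bar>"
      by (intro tendsto_intros g)
  qed (use lip in blast)
  have "continuous_on UNIV g"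
    unfolding continuous_on_iff using glip by (metis dist_commute dist_real_def le_less_trans UNIV_I)
  then have "closed K"
    unfolding K_def using continuous_closed_preimage_constant[of UNIV g 0] by simp
  then have K_compact: "compact K"
    using compact_space closed_Int_compact[of K UNIV] by simp
  have upper: "q \<in> K" if "strict_mono \<tau>" "\<And>j. p j \<in> C (\<sigma> (\<tau> j))" "p \<longlonglongrightarrow> q"
    for \<tau> :: "nat \<Rightarrow> nat" and p q
  proof -
    have "(\<lambda>j. infdist q (C (\<sigma> (\<tau> j)))) \<longlonglongrightarrow> g q"
      using LIMSEQ_subseq_LIMSEQ[OF g that(1)] by (simp add: o_def)
    moreover have "(\<lambda>j. dist q (p j)) \<longlonglongrightarrow> 0"
      using tendsto_dist[OF tendsto_const that(3), of q] by simp
    ultimately have "g q \<le> 0"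
      by (rule LIMSEQ_le) (use that(2) infdist_le in blast)
    moreover have "0 \<le> g q"
      using g infdist_nonneg by (blast intro: LIMSEQ_le_const)
    ultimately show "q \<in> K" by (simp add: K_def)
  qed
  have lower: "(\<lambda>k. infdist p (C (\<sigma> k))) \<longlonglongrightarrow> 0" if "p \<in> K" for p
    using g[of p] that by (simp add: K_def)
  have "connected K"
  proof (rule ccontr)
    assume "\<not> connected K"
    then obtain A B where AB: "closed A" "closed B" "A \<noteq> {}" "B \<noteq> {}" "A \<union> B = K" "A \<inter> B = {}"
      using connected_closed_set[OF \<open>closed K\<close>] by blast
    obtain U V where UV: "open U" "open V" "A \<subseteq> U" "B \<subseteq> V" "U \<inter> V = {}"
      using t4_space[OF AB(1,2,6)] by blast
    have meets: "\<exists>k0. \<forall>k\<ge>k0. W \<inter> C (\<sigma> k) \<noteq> {}" if W: "open W" "a \<in> W" "a \<in> K" for W a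
    proof -
      obtain e where e: "0 < e" "ball a e \<subseteq> W"
        using W(1,2) open_contains_ball by blast
      obtain k0 where k0: "\<And>k. k \<ge> k0 \<Longrightarrow> infdist a (C (\<sigma> k)) < e"
        using LIMSEQ_D[OF lower[OF W(3)] e(1)] by (auto simp: infdist_nonneg)
      have "W \<inter> C (\<sigma> k) \<noteq> {}" if "k \<ge> k0" for k
      proof -
        have "(INF q\<in>C (\<sigma> k). dist a q) < e"
          using k0[OF that] ne by (simp add: infdist_notempty)
        then obtain q where "q \<in> C (\<sigma> k)" "dist a q < e"
          using cInf_lessD[of "dist a ` C (\<sigma> k)" e] ne by auto
        then show ?thesis using e(2) by auto
      qed
      then show ?thesis by blast
    qed
    obtain a b where ab: "a \<in> A" "b \<in> B" using AB by blast
    obtain k1 k2 where k1: "\<And>k. k \<ge> k1 \<Longrightarrow> U \<inter> C (\<sigma> k) \<noteq> {}" and k2: "\<And>k. k \<ge> k2 \<Longrightarrow> V \<inter> C (\<sigma> k) \<noteq> {}"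
      using meets[of U a] meets[of V b] UV AB(5) ab by blast
    have "\<exists>q. q \<in> C (\<sigma> (k + (k1 + k2))) \<and> q \<notin> U \<union> V" for k
    proof (rule ccontr)
      let ?C = "C (\<sigma> (k + (k1 + k2)))"
      assume "\<nexists>q. q \<in> ?C \<and> q \<notin> U \<union> V"
      then have "?C \<subseteq> U \<union> V" "U \<inter> V \<inter> ?C = {}" "U \<inter> ?C \<noteq> {}" "V \<inter> ?C \<noteq> {}"
        using UV(5) k1 k2 by auto
      then show False
        using connectedD[OF conn UV(1,2)] by blast
    qed
    then obtain q where q: "\<And>k. q k \<in> C (\<sigma> (k + (k1 + k2)))" "\<And>k. q k \<notin> U \<union> V" by metis
    obtain l \<rho> where \<rho>: "strict_mono (\<rho> :: nat \<Rightarrow> nat)" "(q \<circ> \<rho>) \<longlonglongrightarrow> l"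
      using seqc by blast
    have "l \<in> K"
      using \<rho> q(1) by (intro upper[of "\<lambda>j. \<rho> j + (k1 + k2)" "q \<circ> \<rho>"]) (auto simp: strict_mono_def)
    moreover have "l \<in> - (U \<union> V)"
      by (rule closed_sequentially[OF _ _ \<rho>(2)]) (use q(2) UV(1,2) in auto)
    ultimately show False using AB(5) UV(3,4) by blast
  qed
  have "kuratowski_limit (C \<circ> \<sigma>) K"
    unfolding kuratowski_limit_def o_apply
    by (intro conjI ballI allI impI) (erule lower, rule upper, auto)
  then show ?thesis
    using \<sigma> K_compact \<open>connected K\<close> by blast
qed

section \<open>Integer iterates\<close>

lemma int_iter_of_nat: "int_iter f (int n) = f ^^ n"
  by (simp add: int_iter_def)

lemma int_iter_succ:
  assumes "bij f"
  shows "int_iter f (i + 1) = f \<circ> int_iter f i"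
proof (cases "i \<ge> 0")
  case True
  then have "nat (i + 1) = Suc (nat i)" by simp
  with True show ?thesis by (simp add: int_iter_def)
next
  case False
  then obtain n where i: "i = - int (Suc n)"
    by (cases i rule: int_cases) auto
  have "f \<circ> inv f = id"
    using surj_iff[THEN iffD1, OF bij_is_surj[OF assms]] .
  then have "f \<circ> (inv f ^^ Suc n) = inv f ^^ n"
    by (simp add: o_assoc)
  moreover have "int_iter f i = inv f ^^ Suc n" "int_iter f (i + 1) = inv f ^^ n"
    unfolding int_iter_def i by (auto simp: nat_add_distrib)
  ultimately show ?thesis by simp
qed

lemma int_iter_add:
  assumes "bij f"
  shows "int_iter f (i + j) x = int_iter f i (int_iter f j x)"
proof (induction i rule: int_induct[where k = 0])
  case base
  show ?case by (simp add: int_iter_def)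
next
  case (step1 i)
  then show ?case
    using int_iter_succ[OF assms, of i] int_iter_succ[OF assms, of "i + j"]
    by (simp add: algebra_simps)
next
  case (step2 i)
  have "f (int_iter f (i - 1 + j) x) = f (int_iter f (i - 1) (int_iter f j x))"
    using step2.IH int_iter_succ[OF assms, of "i - 1"] int_iter_succ[OF assms, of "i - 1 + j"]
    by (simp add: algebra_simps fun_eq_iff)
  then show ?case
    using bij_is_inj[OF assms] by (simp add: inj_eq)
qed

section \<open>Closed balls\<close>

text \<open>
  A point at distance exactly \<open>s\<close> from \<open>x\<close> lies in every ball of radius \<open>t > s\<close>. The closures of these
  balls tend to the closure of the ball of radius \<open>s\<close> as \<open>t\<close> decreases to \<open>s\<close>, so the point lies in
  that closure too.
\<close>

lemma closure_ball_eq_cball: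
  fixes x :: "'a::metric_space"
  assumes compact_space: "compact (UNIV :: 'a set)"
    and cont: "closed_balls_continuous TYPE('a)" and "0 < s"
  shows "closure (ball x s) = cball x s"
proof
  show "closure (ball x s) \<subseteq> cball x s"
    by (rule closure_minimal) auto
  have bdd: "bounded A" for A :: "'a set"
    using compact_imp_bounded[OF compact_space] bounded_subset by blast
  let ?B = "closure (ball x s)"
  show "cball x s \<subseteq> ?B"
  proof
    fix p assume p: "p \<in> cball x s"
    have "infdist p ?B \<le> 0 + e" if "0 < e" for e :: real
    proof -
      have "eventually (\<lambda>(y, t). dist (hausdorff_dist (closure (ball y t)) ?B) 0 < e)
          (at (x, s) within UNIV \<times> {0<..})"
        using cont \<open>0 < s\<close> \<open>0 < e\<close> unfolding closed_balls_continuous_def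
        by (force dest!: spec[of _ x] spec[of _ s] tendstoD simp: case_prod_unfold)
      then obtain d where d: "0 < d" "\<And>y t. 0 < t \<Longrightarrow> (y, t) \<noteq> (x, s) \<Longrightarrow> dist (y, t) (x, s) < d \<Longrightarrow>
          dist (hausdorff_dist (closure (ball y t)) ?B) 0 < e"
        unfolding eventually_at by auto
      let ?A = "closure (ball x (s + d / 2))"
      have h: "hausdorff_dist ?A ?B < e"
        using d(2)[of "s + d / 2" x] d(1) \<open>0 < s\<close> by (simp add: dist_Pair_Pair dist_real_def)
      have "bdd_above ((\<lambda>a. infdist a ?B) ` ?A)"
      proof (rule bdd_aboveI2)
        fix a assume "a \<in> ?A"
        have "x \<in> ?B" using \<open>0 < s\<close> closure_subset[of "ball x s"] by auto
        then have "infdist a ?B \<le> dist a x" by (rule infdist_le)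
        also have "\<dots> \<le> diameter (UNIV :: 'a set)"
          using diameter_bounded_bound[OF bdd] by blast
        finally show "infdist a ?B \<le> diameter (UNIV :: 'a set)" .
      qed
      moreover have "p \<in> ?A"
        using p d(1) closure_subset[of "ball x (s + d / 2)"] by auto
      ultimately have "infdist p ?B \<le> (SUP a\<in>?A. infdist a ?B)"
        by (intro cSUP_upper)
      also have "\<dots> \<le> hausdorff_dist ?A ?B"
        by (simp add: hausdorff_dist_def)
      finally show ?thesis using h by simp
    qed
    then have "infdist p ?B \<le> 0"
      by (rule field_le_epsilon)
    moreover have "?B \<noteq> {}" using \<open>0 < s\<close> by simp
    ultimately show "p \<in> ?B"
      using in_closed_iff_infdist_zero[of ?B p] infdist_nonneg[of p ?B] by auto
  qed
qed

section \<open>Uniform cw-expansivity\<close>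

text \<open>
  Continuity of closed balls is replaced by its consequence \<open>closure (ball x s) = cball x s\<close>, which
  makes diameters of iterated balls continuous in the radius. The constant \<open>c\<close> is a cw-expansivity
  constant, and all balls of radius below \<open>r\<close> are connected.
\<close>

locale cw_system =
  fixes f :: "'a::metric_space \<Rightarrow> 'a" and c r :: real
  assumes compact_space: "compact (UNIV :: 'a set)"
    and connected_space: "connected (UNIV :: 'a set)"
    and nontrivial: "\<nexists>a. (UNIV :: 'a set) = {a}"
    and homeo: "homeo f"
    and c_pos: "0 < c"
    and expansive: "nontrivial_continuum C \<Longrightarrow> \<exists>n. diameter (int_iter f n ` C) > c"
    and r_pos: "0 < r"
    and connected_ball: "0 < s \<Longrightarrow> s < r \<Longrightarrow> connected (ball (x :: 'a) s)"
    and closure_ball: "0 < s \<Longrightarrow> closure (ball (x :: 'a) s) = cball x s"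
begin

abbreviation F :: "int \<Rightarrow> 'a \<Rightarrow> 'a" where
  "F \<equiv> int_iter f"

lemma bounded_set: "bounded (S :: 'a set)"
  using compact_imp_bounded[OF compact_space] bounded_subset by blast

lemma dist_le_diameter: "x \<in> S \<Longrightarrow> y \<in> S \<Longrightarrow> dist x y \<le> diameter (S :: 'a set)"
  using diameter_bounded_bound[OF bounded_set] by blast

lemma diameter_mono: "S \<subseteq> T \<Longrightarrow> diameter S \<le> diameter (T :: 'a set)"
  using diameter_subset[OF _ bounded_set] by blast

lemmas diam_gt_iff = diameter_gt_iff[OF compact_space]

lemma diam_leI: "0 \<le> e \<Longrightarrow> (\<And>x y. x \<in> S \<Longrightarrow> y \<in> S \<Longrightarrow> dist x y \<le> e) \<Longrightarrow> diameter (S :: 'a set) \<le> e"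
  using diam_gt_iff[of e S] by (meson not_le)

lemma bij_f: "bij f"
  using homeo unfolding homeo_def homeomorphism_def
  by (metis UNIV_I bijI' surj_def)

lemma F_add: "F (i + j) x = F i (F j x)"
  by (rule int_iter_add[OF bij_f])

lemma F_inverse [simp]: "F i (F (- i) x) = x"
  using F_add[of i "- i" x] by (simp add: int_iter_def)

lemma F_add_image: "F i ` F j ` S = F (i + j) ` S"
  by (auto simp: F_add image_image)

lemma continuous_F: "continuous_on S (F i)"
proof -
  obtain g where g: "homeomorphism UNIV UNIV f g"
    using homeo unfolding homeo_def by blast
  then have "inv f = g"
    by (intro inv_unique_comp) (auto simp: homeomorphism_def fun_eq_iff)
  then have "continuous_on UNIV f" "continuous_on UNIV (inv f)"
    using g by (auto simp: homeomorphism_def)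
  have pow: "continuous_on UNIV (h ^^ n)" if "continuous_on UNIV h" for h :: "'a \<Rightarrow> 'a" and n
  proof (induction n)
    case (Suc n)
    then have "continuous_on UNIV (h \<circ> (h ^^ n))"
      using that by (intro continuous_on_compose) (auto intro: continuous_on_subset)
    then show ?case by simp
  qed (simp add: id_def)
  have "continuous_on UNIV (F i)"
    unfolding int_iter_def
    using pow[OF \<open>continuous_on UNIV f\<close>] pow[OF \<open>continuous_on UNIV (inv f)\<close>] by simp
  then show ?thesis using continuous_on_subset by blast
qed

lemma uniform_F: "0 < e \<Longrightarrow> \<exists>d>0. \<forall>x y. dist x y < d \<longrightarrow> dist (F i x) (F i y) < e"
  using compact_uniformly_continuous[OF continuous_F compact_space, of i]
  unfolding uniformly_continuous_on_def by (metis UNIV_I)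

text \<open>
  A set whose iterate is large at some time is itself not small, as long as the time stays in a
  bounded window. This is how the start of an orbit segment is separated from the times at which
  a ball has grown.
\<close>

lemma small_diameter_iterates:
  assumes "0 < e" "finite I"
  shows "\<exists>d>0. \<forall>S. diameter S \<le> d \<longrightarrow> (\<forall>i\<in>I. diameter (F i ` S) < e)"
proof -
  have "\<forall>i. \<exists>d>0. \<forall>S. diameter S \<le> d \<longrightarrow> diameter (F i ` S) < e"
  proof
    fix i
    obtain d where d: "0 < d" "\<And>x y. dist x y < d \<Longrightarrow> dist (F i x) (F i y) < e / 2"
      using uniform_F[of "e / 2" i] \<open>0 < e\<close> by auto
    have "diameter (F i ` S) < e" if "diameter S \<le> d / 2" for S
    proof -
      have "diameter (F i ` S) \<le> e / 2"
      proof (rule diam_leI)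
        fix x y assume "x \<in> F i ` S" "y \<in> F i ` S"
        then obtain x' y' where xy: "x = F i x'" "y = F i y'" "x' \<in> S" "y' \<in> S" by blast
        then have "dist x' y' < d"
          using dist_le_diameter[of x' S y'] that d(1) by linarith
        then show "dist x y \<le> e / 2" using d(2) xy by force
      qed (use \<open>0 < e\<close> in simp)
      then show ?thesis using \<open>0 < e\<close> by simp
    qed
    then show "\<exists>d>0. \<forall>S. diameter S \<le> d \<longrightarrow> diameter (F i ` S) < e"
      using d(1) by (intro exI[of _ "d / 2"]) auto
  qed
  then obtain d where d: "\<And>i. d i > 0" "\<And>i S. diameter S \<le> d i \<Longrightarrow> diameter (F i ` S) < e"
    by metis
  define m where "m = Min (insert 1 (d ` I))"
  have "m > 0" "\<And>i. i \<in> I \<Longrightarrow> m \<le> d i"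
    unfolding m_def using assms(2) d(1) by auto
  then show ?thesis
    using d(2) order_trans by blast
qed

text \<open>
  Expansion past \<open>c\<close> happens within a time \<open>N\<close> that depends on the initial size alone. Otherwise there
  are connected sets of diameter at least \<open>\<eta>\<close> whose iterates do not exceed \<open>c\<close> on longer and longer
  windows, and a limit of them is a non-trivial continuum that violates cw-expansivity.
\<close>

lemma uniform_expansive:
  assumes "0 < \<eta>"
  shows "\<exists>N::nat. \<forall>C. connected C \<longrightarrow> diameter C \<ge> \<eta> \<longrightarrow>
    (\<exists>i. \<bar>i\<bar> \<le> int N \<and> diameter (F i ` C) > c)"
proof (rule ccontr)
  assume "\<not> ?thesis"
  then have "\<forall>N::nat. \<exists>C. connected C \<and> diameter C \<ge> \<eta> \<and>
      (\<forall>i. \<bar>i\<bar> \<le> int N \<longrightarrow> diameter (F i ` C) \<le> c)"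
    by (simp add: not_less)
  from choice[OF this] obtain C :: "nat \<Rightarrow> 'a set" where "\<forall>N. connected (C N) \<and> diameter (C N) \<ge> \<eta> \<and>
      (\<forall>i. \<bar>i\<bar> \<le> int N \<longrightarrow> diameter (F i ` C N) \<le> c)"
    by blast
  then have C: "\<And>N. connected (C N)" "\<And>N. diameter (C N) \<ge> \<eta>"
    and small: "\<And>N i. \<bar>i\<bar> \<le> int N \<Longrightarrow> diameter (F i ` C N) \<le> c"
    by blast+
  have ne: "C n \<noteq> {}" for n using C(2)[of n] \<open>0 < \<eta>\<close> by auto
  obtain \<sigma> K where \<sigma>: "strict_mono \<sigma>" and K: "compact K" "connected K"
    and limit: "kuratowski_limit (C \<circ> \<sigma>) K"
    using connected_sets_subconverge[where C = C, OF compact_space ne C(1)] by blast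
  have lower: "(\<lambda>k. infdist p (C (\<sigma> k))) \<longlonglongrightarrow> 0" if "p \<in> K" for p
    using limit that by (simp add: kuratowski_limit_def)
  have upper: "l \<in> K" if "strict_mono \<tau>" "\<And>j. p j \<in> C (\<sigma> (\<tau> j))" "p \<longlonglongrightarrow> l" for \<tau> p l
    using limit that unfolding kuratowski_limit_def o_apply by blast
  have "\<exists>p q. p \<in> C k \<and> q \<in> C k \<and> dist p q > \<eta> / 2" for k
    using diam_gt_iff[of "\<eta> / 2" "C k"] C(2)[of k] \<open>0 < \<eta>\<close> by force
  then obtain p q where pq: "\<And>k. p k \<in> C k" "\<And>k. q k \<in> C k" "\<And>k. dist (p k) (q k) > \<eta> / 2"
    by metis
  have "\<exists>l. \<exists>\<rho>::nat \<Rightarrow> nat. strict_mono \<rho> \<and> (x \<circ> \<rho>) \<longlonglongrightarrow> l" for x :: "nat \<Rightarrow> 'a"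
    using compact_space by (metis UNIV_I compact_def)
  then obtain a b and \<rho> \<rho>' :: "nat \<Rightarrow> nat" where \<rho>: "strict_mono \<rho>" "(p \<circ> \<sigma> \<circ> \<rho>) \<longlonglongrightarrow> a"
    and \<rho>': "strict_mono \<rho>'" "(q \<circ> \<sigma> \<circ> \<rho> \<circ> \<rho>') \<longlonglongrightarrow> b" by metis
  have a: "(p \<circ> \<sigma> \<circ> \<rho> \<circ> \<rho>') \<longlonglongrightarrow> a"
    using LIMSEQ_subseq_LIMSEQ[OF \<rho>(2) \<rho>'(1)] .
  have "strict_mono (\<rho> \<circ> \<rho>')" using \<rho>(1) \<rho>'(1) by (rule strict_mono_o)
  then have "a \<in> K" "b \<in> K"
    using upper[of "\<rho> \<circ> \<rho>'", OF _ _ a] upper[of "\<rho> \<circ> \<rho>'", OF _ _ \<rho>'(2)] pq(1,2) by auto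
  moreover have "\<eta> / 2 \<le> dist a b"
    by (rule LIMSEQ_le_const[OF tendsto_dist[OF a \<rho>'(2)]]) (use pq(3) less_imp_le in auto)
  ultimately have "nontrivial_continuum K"
    unfolding nontrivial_continuum_def using K \<open>0 < \<eta>\<close> by force
  then obtain i where "diameter (F i ` K) > c" using expansive by blast
  then obtain x y where xy: "x \<in> K" "y \<in> K" "dist (F i x) (F i y) > c"
    using diam_gt_iff[of c "F i ` K"] c_pos by auto
  define e where "e = (dist (F i x) (F i y) - c) / 2"
  obtain d where d: "0 < d" "\<And>x y. dist x y < d \<Longrightarrow> dist (F i x) (F i y) < e"
    using uniform_F[of e i] xy(3) by (auto simp: e_def)
  have "eventually (\<lambda>k. infdist x (C (\<sigma> k)) < d \<and> infdist y (C (\<sigma> k)) < d \<and> nat \<bar>i\<bar> \<le> k) sequentially"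
    using lower[OF xy(1)] lower[OF xy(2)] d(1)
    by (intro eventually_conj eventually_ge_at_top order_tendstoD(2))
  then obtain k where k: "infdist x (C (\<sigma> k)) < d" "infdist y (C (\<sigma> k)) < d" "nat \<bar>i\<bar> \<le> k"
    using eventually_happens'[OF sequentially_bot] by blast
  have near: "\<exists>u\<in>C (\<sigma> k). dist z u < d" if "infdist z (C (\<sigma> k)) < d" for z
    using cInf_lessD[of "dist z ` C (\<sigma> k)" d] that ne by (auto simp: infdist_notempty)
  obtain u v where uv: "u \<in> C (\<sigma> k)" "v \<in> C (\<sigma> k)" "dist x u < d" "dist y v < d"
    using near[OF k(1)] near[OF k(2)] by blast
  have "dist (F i x) (F i y) \<le> dist (F i x) (F i u) + dist (F i u) (F i v) + dist (F i y) (F i v)"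
    using dist_triangle[of "F i x" "F i y" "F i u"] dist_triangle[of "F i u" "F i y" "F i v"]
    by (simp add: dist_commute)
  also have "\<dots> < e + dist (F i u) (F i v) + e"
    using d(2)[OF uv(3)] d(2)[OF uv(4)] by linarith
  finally have "dist (F i u) (F i v) > c" by (simp add: e_def field_simps)
  moreover have "dist (F i u) (F i v) \<le> diameter (F i ` C (\<sigma> k))"
    using uv by (intro dist_le_diameter) auto
  moreover have "\<bar>i\<bar> \<le> int (\<sigma> k)"
    using k(3) seq_suble[OF \<sigma>, of k] by linarith
  ultimately show False using small[of i "\<sigma> k"] by linarith
qed

section \<open>Growth of balls under iteration\<close>

definition spread :: "nat \<Rightarrow> 'a \<Rightarrow> real \<Rightarrow> real" where
  "spread n x s = diameter ((f ^^ n) ` ball x s)"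

lemma spread_F: "spread n x s = diameter (F (int n) ` ball x s)"
  by (simp add: spread_def int_iter_of_nat)

lemma spread_mono: "s \<le> t \<Longrightarrow> spread n x s \<le> spread n x t"
  unfolding spread_def by (intro diameter_mono image_mono subset_ball)

lemma dist_le_spread:
  "dist x p < s \<Longrightarrow> dist x q < s \<Longrightarrow> dist ((f ^^ n) p) ((f ^^ n) q) \<le> spread n x s"
  unfolding spread_def by (intro dist_le_diameter) auto

lemma spread_leI:
  assumes "0 \<le> e"
    and "\<And>p q. dist x p < s \<Longrightarrow> dist x q < s \<Longrightarrow> dist ((f ^^ n) p) ((f ^^ n) q) \<le> e"
  shows "spread n x s \<le> e"
  unfolding spread_def using assms by (intro diam_leI) auto

text \<open>
  Two points of an open ball lie together in a slightly smaller ball.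
\<close>

lemma spread_left_continuous:
  assumes "0 < t" "0 \<le> e" "\<And>s. 0 < s \<Longrightarrow> s < t \<Longrightarrow> spread n x s \<le> e"
  shows "spread n x t \<le> e"
proof (rule spread_leI)
  fix p q assume pq: "dist x p < t" "dist x q < t"
  define s where "s = (max (dist x p) (dist x q) + t) / 2"
  have s: "dist x p < s" "dist x q < s" "s < t"
    using pq by (auto simp: s_def max_def)
  then have "0 < s" using zero_le_dist[of x p] by linarith
  then show "dist ((f ^^ n) p) ((f ^^ n) q) \<le> e"
    using dist_le_spread[OF s(1,2), of n] assms(3)[of s] s(3) by linarith
qed (use assms in simp)

text \<open>
  This uses that the closed ball is the closure of the open one: by compactness a slightly larger ball
  stays in a thin neighbourhood \<open>W\<close> of the open ball, so its image is only slightly larger.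
\<close>

lemma spread_right_continuous:
  assumes "0 < s" "spread n x s < e"
  shows "\<exists>t>s. spread n x t < e"
proof -
  define \<eta> where "\<eta> = (e - spread n x s) / 4"
  have "0 < \<eta>" using assms(2) by (simp add: \<eta>_def)
  obtain d where d: "0 < d" "\<And>p q. dist p q < d \<Longrightarrow> dist ((f ^^ n) p) ((f ^^ n) q) < \<eta>"
    using uniform_F[OF \<open>0 < \<eta>\<close>, of "int n"] by (auto simp: int_iter_of_nat)
  define W where "W = (\<Union>q\<in>ball x s. ball q d)"
  have "open W" by (auto simp: W_def)
  have "cball x s \<subseteq> W"
  proof
    fix p assume "p \<in> cball x s"
    then have "p \<in> closure (ball x s)" using closure_ball[OF \<open>0 < s\<close>] by simp
    then show "p \<in> W"
      using d(1) by (auto simp: W_def closure_approachable)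
  qed
  have "\<exists>t>s. ball x t \<subseteq> W"
  proof (cases "- W = {}")
    case True
    then show ?thesis by (intro exI[of _ "s + 1"]) auto
  next
    case False
    have "compact (- W)"
      using closed_Int_compact[OF _ compact_space, of "- W"] \<open>open W\<close> by (simp add: closed_def)
    then obtain w where w: "w \<in> - W" "\<And>z. z \<in> - W \<Longrightarrow> dist x w \<le> dist x z"
      using continuous_attains_inf[of "- W" "dist x"] False
        continuous_on_dist[OF continuous_on_const continuous_on_id] by blast
    have "dist x w > s" using w(1) \<open>cball x s \<subseteq> W\<close> by force
    moreover have "ball x (dist x w) \<subseteq> W" using w(2) by force
    ultimately show ?thesis by blast
  qed
  then obtain t where t: "t > s" "ball x t \<subseteq> W" by blast
  have "spread n x t \<le> spread n x s + 2 * \<eta>"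
  proof (rule spread_leI)
    fix p q assume "dist x p < t" "dist x q < t"
    then have "p \<in> W" "q \<in> W" using t(2) by auto
    then obtain p' q' where "p' \<in> ball x s" "q' \<in> ball x s" "p \<in> ball p' d" "q \<in> ball q' d"
      unfolding W_def by blast
    then have pq: "dist x p' < s" "dist x q' < s" "dist p' p < d" "dist q' q < d"
      by auto
    let ?g = "f ^^ n"
    have "dist (?g p) (?g q) \<le> dist (?g p') (?g p) + dist (?g p') (?g q') + dist (?g q') (?g q)"
      using dist_triangle[of "?g p" "?g q" "?g p'"] dist_triangle[of "?g p'" "?g q" "?g q'"]
      by (simp add: dist_commute)
    then show "dist (?g p) (?g q) \<le> spread n x s + 2 * \<eta>"
      using d(2)[OF pq(3)] d(2)[OF pq(4)] dist_le_spread[OF pq(1,2), of n] by linarith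
  next
    show "0 \<le> spread n x s + 2 * \<eta>"
      using \<open>0 < \<eta>\<close> diameter_ge_0[OF bounded_set] unfolding spread_def
      by (intro add_nonneg_nonneg) auto
  qed
  also have "\<dots> < e" using \<open>0 < \<eta>\<close> unfolding \<eta>_def by (simp add: field_simps)
  finally show ?thesis using t(1) by blast
qed

lemma small_spread:
  assumes "0 < e"
  shows "\<exists>d>0. \<forall>x s. s \<le> d \<longrightarrow> (\<forall>j\<le>n. spread j x s < e)"
proof -
  obtain d where d: "0 < d" "\<And>S i. diameter S \<le> d \<Longrightarrow> i \<in> int ` {..n} \<Longrightarrow> diameter (F i ` S) < e"
    using small_diameter_iterates[OF assms, of "int ` {..n}"] by auto
  have "spread j x s < e" if "s \<le> d / 2" "j \<le> n" for j x s
  proof -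
    have "diameter (ball x s) \<le> d"
    proof (rule diam_leI)
      fix p q assume "p \<in> ball x s" "q \<in> ball x s"
      then show "dist p q \<le> d"
        using dist_triangle3[of p q x] that(1) by auto
    qed (use d(1) in simp)
    then show ?thesis using d(2) that(2) by (auto simp: spread_F)
  qed
  then show ?thesis using d(1) by (intro exI[of _ "d / 2"]) auto
qed

text \<open>
  An intermediate value property: the largest radius at which no time in \<open>J\<close> exceeds \<open>e\<close> is one at
  which some time in \<open>J\<close> attains \<open>e\<close> exactly. Uniform expansivity applied to that
  iterate then gives a time close by at which the same ball exceeds \<open>c\<close>.
\<close>

lemma critical_radius:
  assumes "0 < e" "finite J" "0 < R" "j \<in> J" "spread j x R > e"
  obtains s where "0 < s" "s < R" "\<And>j. j \<in> J \<Longrightarrow> spread j x s \<le> e"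
    "\<exists>j\<in>J. spread j x s = e"
proof -
  define A where "A = {s. 0 < s \<and> s \<le> R \<and> (\<forall>j\<in>J. spread j x s \<le> e)}"
  obtain d where d: "0 < d" "\<And>s j. s \<le> d \<Longrightarrow> j \<le> Max J \<Longrightarrow> spread j x s < e"
    using small_spread[OF assms(1), of "Max J"] by blast
  have "spread j x (min d R) \<le> e" if "j \<in> J" for j
    using d(2)[of "min d R" j] Max_ge[OF assms(2) that] by (simp add: less_imp_le)
  then have "min d R \<in> A"
    unfolding A_def using d(1) assms(3) by simp
  have bdd: "bdd_above A" by (auto simp: A_def bdd_above_def)
  define s where "s = Sup A"
  have s_ge: "a \<le> s" if "a \<in> A" for a
    unfolding s_def using that bdd by (rule cSup_upper)
  have "0 < s" using s_ge[OF \<open>min d R \<in> A\<close>] d(1) assms(3) by linarith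
  have "s \<le> R"
    unfolding s_def using \<open>min d R \<in> A\<close> by (intro cSup_least) (blast, simp add: A_def)
  have le: "spread j x s \<le> e" if "j \<in> J" for j
  proof (rule spread_left_continuous[OF \<open>0 < s\<close>])
    fix u assume "u < s"
    then obtain a where "a \<in> A" "u < a"
      unfolding s_def using less_cSupD[of A u] \<open>min d R \<in> A\<close> by blast
    then show "spread j x u \<le> e"
      using spread_mono[of u a j x] that by (fastforce simp: A_def)
  qed (use assms in simp)
  then have "s \<noteq> R" using assms(4,5) by force
  with \<open>s \<le> R\<close> have "s < R" by simp
  have "\<exists>j\<in>J. spread j x s = e"
  proof (rule ccontr)
    assume "\<not> ?thesis"
    then have "\<forall>j\<in>J. \<exists>t>s. spread j x t < e"
      using le spread_right_continuous[OF \<open>0 < s\<close>] by (meson less_le)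
    then obtain t where t: "\<And>j. j \<in> J \<Longrightarrow> t j > s" "\<And>j. j \<in> J \<Longrightarrow> spread j x (t j) < e"
      by metis
    define u where "u = Min (insert R (t ` J))"
    have "s < u" "u \<le> R" "\<And>j. j \<in> J \<Longrightarrow> u \<le> t j"
      unfolding u_def using t(1) \<open>s < R\<close> assms(2) by auto
    moreover have "spread j x u \<le> e" if "j \<in> J" for j
      using spread_mono[of u "t j" j x] t(2)[OF that] \<open>\<And>j. j \<in> J \<Longrightarrow> u \<le> t j\<close>[OF that] by linarith
    ultimately have "u \<in> A"
      unfolding A_def using \<open>0 < s\<close> by simp
    then show False using s_ge \<open>s < u\<close> by force
  qed
  then show ?thesis using that \<open>0 < s\<close> \<open>s < R\<close> le by blast
qed

section \<open>Absence of stable balls\<close>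

lemma connected_F_ball: "0 < s \<Longrightarrow> s < r \<Longrightarrow> connected (F i ` ball x s)"
  by (intro connected_continuous_image continuous_F connected_ball)

lemma diameter_ball_le:
  fixes x :: 'a
  assumes "0 \<le> s"
  shows "diameter (ball x s) \<le> 2 * s"
proof (rule diam_leI)
  fix p q assume "p \<in> ball x s" "q \<in> ball x s"
  then show "dist p q \<le> 2 * s"
    using dist_triangle3[of p q x] by auto
qed (use assms in simp)

text \<open>
  Suppose that a tiny ball is larger than \<open>c\<close> at time \<open>n\<close> and tiny again at time \<open>m\<close>. Shrink it until
  its maximal size over the times \<open>0, \<dots>, m\<close> is exactly \<open>c\<close>, attained at \<open>j\<close>. Within \<open>N\<close> steps of \<open>j\<close>
  its size exceeds \<open>c\<close>. That time is not in \<open>0, \<dots>, m\<close> by the choice of radius. It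
  is not outside either, since then \<open>j\<close> would be within \<open>N\<close> steps of \<open>0\<close> or \<open>m\<close>, where the ball is
  tiny, and so its size at time \<open>j\<close> would be less than \<open>c\<close>.
\<close>

lemma large_balls_stay_large:
  "\<exists>\<delta>>0. \<forall>x s n m. 0 < s \<longrightarrow> s < r \<longrightarrow> diameter (ball x s) \<le> \<delta> \<longrightarrow> n \<le> m \<longrightarrow>
     spread n x s > c \<longrightarrow> spread m x s > \<delta>"
proof -
  obtain N where N: "\<And>C. connected C \<Longrightarrow> diameter C \<ge> c \<Longrightarrow>
      \<exists>i. \<bar>i\<bar> \<le> int N \<and> diameter (F i ` C) > c"
    using uniform_expansive[OF c_pos] by blast
  obtain \<delta> where \<delta>: "0 < \<delta>"
    "\<And>S i. diameter S \<le> \<delta> \<Longrightarrow> i \<in> {- int N..int N} \<Longrightarrow> diameter (F i ` S) < c"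
    using small_diameter_iterates[OF c_pos, of "{- int N..int N}"] by auto
  have "spread m x s > \<delta>"
    if s: "0 < s" "s < r" and ball: "diameter (ball x s) \<le> \<delta>" and "n \<le> m" "spread n x s > c"
    for x s n m
  proof (rule ccontr)
    assume "\<not> \<delta> < spread m x s"
    obtain s' where s': "0 < s'" "s' < s" and le: "\<And>j. j \<in> {..m} \<Longrightarrow> spread j x s' \<le> c"
      and ex: "\<exists>j\<in>{..m}. spread j x s' = c"
      using critical_radius[OF c_pos, of "{..m}" s n x] s(1) \<open>n \<le> m\<close> \<open>spread n x s > c\<close>
      by auto
    obtain j where j: "j \<le> m" "spread j x s' = c" using ex by auto
    have sub: "ball x s' \<subseteq> ball x s" using s' by auto
    obtain i where i: "\<bar>i\<bar> \<le> int N" "diameter (F i ` F (int j) ` ball x s') > c"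
      using N[OF connected_F_ball[of s' "int j" x]] j(2) s' s(2) by (auto simp: spread_F)
    then have ij: "diameter (F (i + int j) ` ball x s') > c"
      by (simp add: F_add_image)
    consider "i + int j < 0" | "0 \<le> i + int j" "i + int j \<le> int m" | "i + int j > int m"
      by linarith
    then show False
    proof cases
      case 1
      then have "int j \<in> {- int N..int N}" using i(1) by auto
      moreover have "diameter (ball x s') \<le> \<delta>"
        using diameter_mono[OF sub] ball by linarith
      ultimately have "spread j x s' < c"
        using \<delta>(2) by (simp add: spread_F)
      then show False using j(2) by simp
    next
      case 2
      then have "i + int j = int (nat (i + int j))" "nat (i + int j) \<le> m" by auto
      then show False
        using le[of "nat (i + int j)"] ij by (metis atMost_iff not_le spread_F)
    next
      case 3
      have "diameter (F (int m) ` ball x s') \<le> \<delta>"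
        using diameter_mono[OF image_mono[OF sub], of "F (int m)"] \<open>\<not> \<delta> < spread m x s\<close>
        by (simp add: spread_F)
      moreover have "int j - int m \<in> {- int N..int N}" using 3 i(1) j(1) by auto
      ultimately have "diameter (F (int j - int m) ` F (int m) ` ball x s') < c"
        by (rule \<delta>(2))
      then show False using j(2) by (simp add: spread_F F_add_image)
    qed
  qed
  then show ?thesis using \<delta>(1) by blast
qed

text \<open>
  If all forward iterates of a ball have diameter at most \<open>c\<close>, then the iterates contract uniformly
  along the backward orbit of each of its points \<open>a\<close>: for large \<open>n\<close> the ball of the fixed radius \<open>\<rho>\<close> around \<open>f\<^sup>-\<^sup>n a\<close> is
  mapped by \<open>f ^^ n\<close> into an arbitrarily small neighbourhood of \<open>a\<close> (fact \<open>contract\<close>). Hence for \<open>n\<close>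
  large, any prescribed number of points of the ball have \<open>n\<close>-th preimages that are pairwise
  at least \<open>\<rho>\<close> apart. The space has no isolated points, so there are arbitrarily many such points,
  which contradicts total boundedness.
\<close>

lemma no_stable_ball:
  assumes "0 < R"
  shows "\<exists>n. spread n x R > c"
proof (rule ccontr)
  assume "\<not> ?thesis"
  then have stable: "spread n x R \<le> c" for n by (meson not_le)
  obtain \<delta> where \<delta>: "0 < \<delta>" and stay: "\<And>y s n m. 0 < s \<Longrightarrow> s < r \<Longrightarrow> diameter (ball y s) \<le> \<delta> \<Longrightarrow>
      n \<le> m \<Longrightarrow> spread n y s > c \<Longrightarrow> spread m y s > \<delta>"
    using large_balls_stay_large by blast
  define \<rho> where "\<rho> = min (r / 2) (\<delta> / 2)"
  have \<rho>: "0 < \<rho>" "\<rho> < r" "2 * \<rho> \<le> \<delta>" using r_pos \<delta> by (auto simp: \<rho>_def)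
  \<comment> \<open>If contraction fails, take the radius at which the diameter at time \<open>n\<close> is exactly \<open>\<eta>\<close>. Within
    \<open>N\<close> steps of \<open>n\<close> this ball exceeds \<open>c\<close>: after \<open>n\<close> that is excluded by stability, and before \<open>n\<close>
    it would force the diameter at time \<open>n\<close> to exceed \<open>\<delta>\<close>.\<close>
  have contract: "\<exists>N. \<forall>n\<ge>N. \<forall>a. cball a \<eta> \<subseteq> ball x R \<longrightarrow> spread n (F (- int n) a) \<rho> \<le> \<eta>"
    if \<eta>: "0 < \<eta>" "\<eta> < \<delta>" for \<eta>
  proof -
    obtain N where N: "\<And>C. connected C \<Longrightarrow> diameter C \<ge> \<eta> \<Longrightarrow>
        \<exists>i. \<bar>i\<bar> \<le> int N \<and> diameter (F i ` C) > c"
      using uniform_expansive[OF \<eta>(1)] by blast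
    have "spread n (F (- int n) a) \<rho> \<le> \<eta>" if "n \<ge> N" "cball a \<eta> \<subseteq> ball x R" for n a
    proof (rule ccontr)
      define y where "y = F (- int n) a"
      assume "\<not> spread n (F (- int n) a) \<rho> \<le> \<eta>"
      then obtain s where s: "0 < s" "s < \<rho>" "spread n y s = \<eta>"
        using critical_radius[OF \<eta>(1), of "{n}" \<rho> n y] \<rho>(1) by (auto simp: y_def)
      let ?D = "F (int n) ` ball y s"
      obtain i where i: "\<bar>i\<bar> \<le> int N" "diameter (F i ` ?D) > c"
        using N[OF connected_F_ball[of s "int n" y]] s \<rho>(2) by (auto simp: spread_F)
      show False
      proof (cases "i \<ge> 0")
        case True
        have "a \<in> ?D"
          using s(1) by (auto simp: y_def intro!: image_eqI[of _ _ "F (- int n) a"])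
        then have "?D \<subseteq> cball a \<eta>"
          using dist_le_diameter[of a ?D] s(3) by (auto simp: spread_F)
        then have "F i ` ?D \<subseteq> F i ` ball x R" using that(2) by blast
        then have "diameter (F i ` ?D) \<le> diameter (F i ` ball x R)" by (rule diameter_mono)
        also have "\<dots> = spread (nat i) x R" using True by (simp add: spread_F)
        finally show False using stable[of "nat i"] i(2) by linarith
      next
        case False
        define k where "k = nat (i + int n)"
        have k: "k \<le> n" "i + int n = int k" using False i(1) \<open>n \<ge> N\<close> by (auto simp: k_def)
        have "spread k y s > c" using i(2) k(2) by (simp add: spread_F F_add_image)
        moreover have "diameter (ball y s) \<le> \<delta>"
          using diameter_ball_le[of s y] s \<rho>(3) by linarith
        ultimately have "spread n y s > \<delta>"
          using stay[of s y k n] s \<rho>(2) k(1) by linarith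
        then show False using s(3) \<eta>(2) by linarith
      qed
    qed
    then show ?thesis by blast
  qed
  obtain K :: "'a set" where K: "finite K" "UNIV \<subseteq> (\<Union>z\<in>K. ball z (\<rho> / 2))"
    using compact_eq_totally_bounded[of "UNIV :: 'a set"] compact_space \<rho>(1)
    by (metis half_gt_zero)
  have "x islimpt (UNIV :: 'a set)"
    using connected_imp_perfect[OF connected_space] nontrivial by blast
  then have "infinite (ball x R)"
    using islimpt_eq_infinite_ball[of x UNIV] \<open>0 < R\<close> by simp
  then obtain A where A: "finite A" "card A = Suc (card K)" "A \<subseteq> ball x R"
    using infinite_arbitrarily_large by blast
  \<comment> \<open>Half the minimum of \<open>E\<close> is an \<open>\<eta>\<close> below \<open>\<delta>\<close>, below the distances from \<open>A\<close> to the complement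
    of the ball, and below all distances in \<open>A\<close>.\<close>
  define E where "E = insert \<delta> ((\<lambda>a. R - dist x a) ` A \<union> (\<lambda>(a, b). dist a b) ` {(a, b) \<in> A \<times> A. a \<noteq> b})"
  have "finite {(a, b) \<in> A \<times> A. a \<noteq> b}"
    by (rule finite_subset[OF _ finite_cartesian_product[OF A(1) A(1)]]) auto
  then have "finite E" using A(1) by (simp add: E_def)
  define \<eta> where "\<eta> = Min E / 2"
  have "0 < Min E"
    using \<open>finite E\<close> A(3) \<delta> by (subst Min_gr_iff) (auto simp: E_def)
  have \<eta>_less: "\<eta> < e" if "e \<in> E" for e
    using Min_le[OF \<open>finite E\<close> that] \<open>0 < Min E\<close> by (simp add: \<eta>_def)
  have "0 < \<eta>" "\<eta> < \<delta>"
    using \<open>0 < Min E\<close> \<eta>_less by (auto simp: \<eta>_def E_def)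
  have inside: "cball a \<eta> \<subseteq> ball x R" if "a \<in> A" for a
  proof
    fix y assume "y \<in> cball a \<eta>"
    moreover have "\<eta> < R - dist x a" using that by (intro \<eta>_less) (simp add: E_def)
    ultimately show "y \<in> ball x R" using dist_triangle[of x y a] by simp
  qed
  have sep: "\<eta> < dist a b" if "a \<in> A" "b \<in> A" "a \<noteq> b" for a b
    using that by (intro \<eta>_less) (force simp: E_def)
  obtain n where n: "\<And>a. cball a \<eta> \<subseteq> ball x R \<Longrightarrow> spread n (F (- int n) a) \<rho> \<le> \<eta>"
    using contract[OF \<open>0 < \<eta>\<close> \<open>\<eta> < \<delta>\<close>] by blast
  have "\<forall>a. \<exists>z\<in>K. F (- int n) a \<in> ball z (\<rho> / 2)"
    using K(2) by blast
  then obtain z where z: "\<And>a. z a \<in> K" "\<And>a. F (- int n) a \<in> ball (z a) (\<rho> / 2)"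
    by metis
  have "\<not> inj_on z A"
  proof
    assume "inj_on z A"
    then have "card A \<le> card K" using z(1) K(1) by (intro card_inj_on_le[of z]) auto
    then show False using A(2) by simp
  qed
  then obtain a b where ab: "a \<in> A" "b \<in> A" "a \<noteq> b" "z a = z b"
    by (auto simp: inj_on_def)
  let ?a = "F (- int n) a" and ?b = "F (- int n) b"
  have "dist ?a ?b < \<rho>"
    using z(2)[of a] z(2)[of b] ab(4) dist_triangle_half_r[of "z a" ?a \<rho> ?b] by simp
  then have "dist ((f ^^ n) ?a) ((f ^^ n) ?b) \<le> spread n ?a \<rho>"
    using \<rho>(1) by (intro dist_le_spread) auto
  moreover have "(f ^^ n) ?a = a" "(f ^^ n) ?b = b"
    using F_inverse[of "int n"] by (simp_all add: int_iter_of_nat)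
  ultimately show False
    using n[OF inside[OF ab(1)]] sep[OF ab(1-3)] by simp
qed

lemma uniform_sensitivity_time:
  assumes "0 < s"
  shows "\<exists>M. \<forall>x. \<exists>n\<le>M. spread n x s > c"
proof -
  obtain K :: "'a set" where K: "finite K" "UNIV \<subseteq> (\<Union>z\<in>K. ball z (s / 2))"
    using compact_eq_totally_bounded[of "UNIV :: 'a set"] compact_space assms
    by (metis half_gt_zero)
  obtain t where t: "\<And>z. spread (t z) z (s / 2) > c"
    using no_stable_ball[of "s / 2"] assms by (metis half_gt_zero)
  have "\<exists>n\<le>Max (t ` K). spread n x s > c" for x
  proof -
    obtain z where z: "z \<in> K" "dist z x < s / 2"
      using subsetD[OF K(2) UNIV_I[of x]] by auto
    have "ball z (s / 2) \<subseteq> ball x s"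
    proof
      fix y assume "y \<in> ball z (s / 2)"
      then show "y \<in> ball x s" using z(2) dist_triangle_half_r[of z x s y] by simp
    qed
    then have "spread (t z) z (s / 2) \<le> spread (t z) x s"
      unfolding spread_def by (intro diameter_mono image_mono)
    then show ?thesis
      using t[of z] z(1) K(1) by (intro exI[of _ "t z"]) auto
  qed
  then show ?thesis by blast
qed

text \<open>
  If an iterated ball has diameter above \<open>c\<close>, one of two points that are more than \<open>c\<close> apart is more than
  \<open>c / 2\<close> away from the image of the centre.
\<close>

lemma half_expansivity_constant_is_sensitivity_constant: "sensitivity_constant f (c / 2)"
  unfolding sensitivity_constant_def
proof (intro conjI allI impI)
  fix x and \<delta> :: real assume "0 < \<delta>"
  define s where "s = min \<delta> (c / 2)"
  have "0 < s" using \<open>0 < \<delta>\<close> c_pos by (simp add: s_def)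
  then obtain n where "spread n x s > c" using no_stable_ball by blast
  then obtain p q where pq: "dist x p < s" "dist x q < s" "dist ((f ^^ n) p) ((f ^^ n) q) > c"
    using diam_gt_iff[of c] c_pos by (auto simp: spread_def)
  \<comment> \<open>The radius is at most \<open>c / 2\<close>, so the ball itself has diameter at most \<open>c\<close>.\<close>
  have "n \<noteq> 0"
  proof
    assume "n = 0"
    then have "dist p q > c" using pq(3) by simp
    then show False
      using dist_triangle3[of p q x] pq(1,2) by (auto simp: s_def)
  qed
  then have "n \<ge> 1" by simp
  have "dist ((f ^^ n) x) ((f ^^ n) p) > c / 2 \<or> dist ((f ^^ n) x) ((f ^^ n) q) > c / 2"
    using dist_triangle3[of "(f ^^ n) p" "(f ^^ n) q" "(f ^^ n) x"] pq(3) by linarith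
  then show "\<exists>y. dist x y < \<delta> \<and> (\<exists>n\<ge>1. c / 2 < dist ((f ^^ n) x) ((f ^^ n) y))"
    using pq(1,2) \<open>n \<ge> 1\<close> by (auto simp: s_def)
qed (use c_pos in simp)

section \<open>First increasing times\<close>

abbreviation T :: "'a \<Rightarrow> real \<Rightarrow> real \<Rightarrow> nat" where
  "T \<equiv> first_incr_time f"

lemma T_le: "spread n x s > \<gamma> \<Longrightarrow> T x s \<gamma> \<le> n"
  unfolding first_incr_time_def spread_def by (rule Least_le)

lemma spread_T:
  assumes "0 < s" "\<gamma> \<le> c"
  shows "spread (T x s \<gamma>) x s > \<gamma>"
proof -
  obtain n where "spread n x s > \<gamma>"
    using no_stable_ball[OF assms(1), of x] assms(2) by (meson le_less_trans)
  then show ?thesis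
    unfolding first_incr_time_def spread_def by (rule LeastI)
qed

lemma T_mono: "0 < s \<Longrightarrow> \<gamma> \<le> \<gamma>' \<Longrightarrow> \<gamma>' \<le> c \<Longrightarrow> T x s \<gamma> \<le> T x s \<gamma>'"
  using spread_T[of s \<gamma>' x] by (intro T_le) simp

lemma T_antimono: "0 < s \<Longrightarrow> s \<le> t \<Longrightarrow> \<gamma> \<le> c \<Longrightarrow> T x t \<gamma> \<le> T x s \<gamma>"
  using spread_T[of s \<gamma> x] spread_mono[of s t _ x] by (intro T_le) (meson less_le_trans)

text \<open>
  If the ball first exceeds \<open>\<gamma>\<close> at time \<open>t\<close>, then it exceeds \<open>c\<close> within \<open>N\<close> steps of \<open>t\<close>. For small radii
  \<open>t > N\<close>, so that time is not negative; for the other radii both first increasing times are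
  bounded by uniform sensitivity.
\<close>

lemma bounded_delay:
  assumes "0 < \<gamma>" "\<epsilon> \<le> c" "\<gamma> \<le> c"
  shows "\<exists>m. \<forall>x s. 0 < s \<longrightarrow> s < r \<longrightarrow> T x s \<epsilon> \<le> T x s \<gamma> + m"
proof -
  obtain N where N: "\<And>C. connected C \<Longrightarrow> diameter C \<ge> \<gamma> \<Longrightarrow>
      \<exists>i. \<bar>i\<bar> \<le> int N \<and> diameter (F i ` C) > c"
    using uniform_expansive[OF assms(1)] by blast
  obtain d where d: "0 < d" "\<And>x s j. s \<le> d \<Longrightarrow> j \<le> N \<Longrightarrow> spread j x s < \<gamma>"
    using small_spread[OF assms(1), of N] by blast
  obtain M where M: "\<And>x. \<exists>n\<le>M. spread n x d > c"
    using uniform_sensitivity_time[OF d(1)] by blast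
  have "T x s \<epsilon> \<le> T x s \<gamma> + (N + M)" if s: "0 < s" "s < r" for x s
  proof (cases "s \<le> d")
    case True
    let ?t = "T x s \<gamma>"
    have t: "spread ?t x s > \<gamma>" using spread_T[OF s(1) assms(3)] .
    then have "N < ?t" using d(2)[OF True] by (meson less_asym not_le)
    obtain i where i: "\<bar>i\<bar> \<le> int N" "diameter (F i ` F (int ?t) ` ball x s) > c"
      using N[OF connected_F_ball[OF s, of "int ?t" x]] t by (auto simp: spread_F)
    define k where "k = nat (i + int ?t)"
    have k: "i + int ?t = int k" "k \<le> ?t + N" using i(1) \<open>N < ?t\<close> by (auto simp: k_def)
    have "spread k x s > \<epsilon>"
      using i(2) assms(2) by (simp add: spread_F F_add_image k(1))
    then show ?thesis using T_le k(2) by fastforce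
  next
    case False
    obtain n where n: "n \<le> M" "spread n x d > c" using M by blast
    have "spread n x s > \<epsilon>"
      using spread_mono[of d s n x] False n(2) assms(2) by linarith
    then show ?thesis using T_le n(1) by fastforce
  qed
  then show ?thesis by blast
qed

text \<open>
  At the radius where the maximal size over the times \<open>0, \<dots>, n\<close> is exactly \<open>\<epsilon>\<close>, the first increasing time
  is larger than \<open>n\<close>, and by uniform expansivity it is at most \<open>n + N\<close>. Thus the first increasing
  time has no long jumps as the radius shrinks. The radius \<open>\<rho>\<close> is so small that a ball of
  radius below \<open>\<rho>\<close> reaches \<open>\<epsilon>\<close> after time \<open>N\<close> at the earliest, which keeps all times nonnegative.
\<close>

lemma critical_radii_with_linear_times:
  assumes "0 < \<epsilon>" "\<epsilon> < c"
  obtains \<rho> M N where "0 < \<rho>" "\<rho> < r" "\<And>x. T x \<rho> \<epsilon> \<le> M"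
    "\<And>n x. n \<ge> M \<Longrightarrow> \<exists>s. 0 < s \<and> s < \<rho> \<and> n < T x s \<epsilon> \<and> T x s \<epsilon> \<le> n + N"
proof -
  obtain N where N: "\<And>C. connected C \<Longrightarrow> diameter C \<ge> \<epsilon> \<Longrightarrow>
      \<exists>i. \<bar>i\<bar> \<le> int N \<and> diameter (F i ` C) > c"
    using uniform_expansive[OF assms(1)] by blast
  obtain d where d: "0 < d" "\<And>x s j. s \<le> d \<Longrightarrow> j \<le> N \<Longrightarrow> spread j x s < \<epsilon>"
    using small_spread[OF assms(1), of N] by blast
  define \<rho> where "\<rho> = min d (r / 2)"
  have \<rho>: "0 < \<rho>" "\<rho> < r" "\<rho> \<le> d" using d(1) r_pos by (auto simp: \<rho>_def)
  obtain M where M: "\<And>x. \<exists>n\<le>M. spread n x \<rho> > c"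
    using uniform_sensitivity_time[OF \<rho>(1)] by blast
  have M': "\<exists>n\<le>M. spread n x \<rho> > \<epsilon>" for x
    using M[of x] assms(2) by (meson less_trans)
  have TM: "T x \<rho> \<epsilon> \<le> M" for x
  proof -
    obtain n where "n \<le> M" "spread n x \<rho> > \<epsilon>" using M'[of x] by blast
    then show ?thesis using T_le[of \<epsilon> n x \<rho>] by simp
  qed
  moreover have "\<exists>s. 0 < s \<and> s < \<rho> \<and> n < T x s \<epsilon> \<and> T x s \<epsilon> \<le> n + N" if "n \<ge> M" for n x
  proof -
    obtain j0 where "j0 \<le> M" "spread j0 x \<rho> > \<epsilon>"
      using M'[of x] by blast
    then obtain s where s: "0 < s" "s < \<rho>"
      and le: "\<And>j. j \<in> {..n} \<Longrightarrow> spread j x s \<le> \<epsilon>"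
      and ex: "\<exists>j\<in>{..n}. spread j x s = \<epsilon>"
      using critical_radius[OF assms(1), of "{..n}" \<rho> j0 x] \<rho>(1) \<open>n \<ge> M\<close> by auto
    have "n < T x s \<epsilon>"
      using le[of "T x s \<epsilon>"] spread_T[OF s(1), of \<epsilon> x] assms(2) by fastforce
    obtain j where j: "j \<le> n" "spread j x s = \<epsilon>" using ex by auto
    have "s \<le> d" "s < r" using s(2) \<rho> by auto
    have "N < j" using d(2)[OF \<open>s \<le> d\<close>, of j x] j(2) by (meson less_irrefl not_le)
    obtain i where i: "\<bar>i\<bar> \<le> int N" "diameter (F i ` F (int j) ` ball x s) > c"
      using N[OF connected_F_ball[OF s(1) \<open>s < r\<close>, of "int j" x]] j(2) by (auto simp: spread_F)
    define k where "k = nat (i + int j)"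
    have k: "i + int j = int k" "k \<le> n + N" using i(1) \<open>N < j\<close> j(1) by (auto simp: k_def)
    have "spread k x s > \<epsilon>"
      using i(2) assms(2) by (simp add: spread_F F_add_image k(1))
    then have "T x s \<epsilon> \<le> n + N" using T_le[of \<epsilon> k x s] k(2) by simp
    then show ?thesis using s \<open>n < T x s \<epsilon>\<close> by blast
  qed
  ultimately show ?thesis by (rule that[OF \<rho>(1,2)])
qed

text \<open>
  Choose the \<open>k\<close>-th radius so that its first increasing time lies in an interval of \<open>N\<close> integers after
  \<open>M + k * (N + 1)\<close>. These intervals are disjoint, so the times increase strictly with \<open>k\<close> and
  with bounded steps, and then the radii decrease strictly to \<open>0\<close>. The times for smaller \<open>\<gamma>\<close>
  differ by a bounded delay.
\<close>

lemma cw_system_first_time_sensitive: "first_time_sensitive f"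
proof -
  define \<epsilon> where "\<epsilon> = c / 2"
  have \<epsilon>: "0 < \<epsilon>" "\<epsilon> < c" using c_pos by (auto simp: \<epsilon>_def)
  obtain \<rho> M N where \<rho>: "0 < \<rho>" "\<rho> < r" "\<And>x. T x \<rho> \<epsilon> \<le> M"
    and ex: "\<And>n x. n \<ge> M \<Longrightarrow> \<exists>s. 0 < s \<and> s < \<rho> \<and> n < T x s \<epsilon> \<and> T x s \<epsilon> \<le> n + N"
    using critical_radii_with_linear_times[OF \<epsilon>] by blast
  then have "\<forall>k x. \<exists>s. 0 < s \<and> s < \<rho> \<and> M + k * (N + 1) < T x s \<epsilon> \<and> T x s \<epsilon> \<le> M + k * (N + 1) + N"
    by simp
  then obtain S where S: "\<And>k x. 0 < S k x" "\<And>k x. S k x < \<rho>"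
    "\<And>k x. M + k * (N + 1) < T x (S k x) \<epsilon>" "\<And>k x. T x (S k x) \<epsilon> \<le> M + k * (N + 1) + N"
    by metis
  \<comment> \<open>The first radius is required to be constant, so \<open>S 1\<close> is replaced by \<open>\<rho>\<close>, whose times are at
    most \<open>M\<close>.\<close>
  define R where "R = (\<lambda>k x. if k \<le> 1 then \<rho> else S k x)"
  have R: "0 < R k x" "R k x < r" for k x
    using \<rho> S(1)[of k x] S(2)[of k x] by (auto simp: R_def)
  have grow: "T x (R k x) \<epsilon> < T x (R (Suc k) x) \<epsilon>" if "k \<ge> 1" for k x
  proof (cases "k = 1")
    case True
    then show ?thesis using \<rho>(3)[of x] S(3)[of "Suc 1" x] by (simp add: R_def)
  next
    case False
    then show ?thesis using that S(4)[of x k] S(3)[of "Suc k" x] by (simp add: R_def)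
  qed
  \<comment> \<open>The bound \<open>M + 3 * N + 2 = M + 2 * (N + 1) + N\<close> is the largest possible second time; every later
    step is at most \<open>2 * N + 1\<close>.\<close>
  have step: "T x (R (Suc k) x) \<epsilon> \<le> T x (R k x) \<epsilon> + (M + 3 * N + 2)" if "k \<ge> 1" for k x
  proof (cases "k = 1")
    case True
    then show ?thesis using S(4)[of x "Suc 1"] by (simp add: R_def)
  next
    case False
    then show ?thesis using that S(3)[of k x] S(4)[of x "Suc k"] by (simp add: R_def)
  qed
  have decreasing: "R (Suc k) x < R k x" if "k \<ge> 1" for k x
    using grow[OF that, of x] T_antimono[of "R k x" "R (Suc k) x" \<epsilon> x] R \<epsilon> by (meson less_imp_le not_le)
  have limit: "(\<lambda>k. R k x) \<longlonglongrightarrow> 0" for x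
  proof (rule LIMSEQ_I)
    fix e :: real assume "0 < e"
    have "norm (R k x - 0) < e" if k: "k \<ge> T x e \<epsilon> + 2" for k
    proof (rule ccontr)
      assume "\<not> ?thesis"
      then have "e \<le> R k x" using R(1)[of k x] by simp
      then have "T x (R k x) \<epsilon> \<le> T x e \<epsilon>" using \<open>0 < e\<close> \<epsilon> by (intro T_antimono) auto
      moreover have "k < T x (R k x) \<epsilon>" using S(3)[of k x] k by (simp add: R_def)
      ultimately show False using k by simp
    qed
    then show "\<exists>k0. \<forall>k\<ge>k0. norm (R k x - 0) < e" by blast
  qed
  have times: "\<exists>m::real. m > 0 \<and> (\<forall>x. \<forall>k\<ge>1. R k x \<le> \<gamma> \<longrightarrow>
      \<bar>real (T x (R (Suc k) x) \<gamma>) - real (T x (R k x) \<gamma>)\<bar> \<le> m \<and>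
      \<bar>real (T x (R k x) \<gamma>) - real (T x (R k x) \<epsilon>)\<bar> \<le> m)"
    if \<gamma>: "0 < \<gamma>" "\<gamma> \<le> \<epsilon>" for \<gamma>
  proof -
    obtain D where D: "\<And>x s. 0 < s \<Longrightarrow> s < r \<Longrightarrow> T x s \<epsilon> \<le> T x s \<gamma> + D"
      using bounded_delay[OF \<gamma>(1), of \<epsilon>] \<gamma>(2) \<epsilon>(2) by auto
    let ?m = "real (D + (M + 3 * N + 2))"
    have "\<bar>real (T x (R (Suc k) x) \<gamma>) - real (T x (R k x) \<gamma>)\<bar> \<le> ?m \<and>
        \<bar>real (T x (R k x) \<gamma>) - real (T x (R k x) \<epsilon>)\<bar> \<le> ?m" if "k \<ge> 1" for x k
    proof -
      have "T x (R k x) \<gamma> \<le> T x (R k x) \<epsilon>" "T x (R (Suc k) x) \<gamma> \<le> T x (R (Suc k) x) \<epsilon>"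
        using \<gamma> \<epsilon> R by (auto intro!: T_mono)
      moreover have "T x (R k x) \<epsilon> \<le> T x (R k x) \<gamma> + D" using D R by blast
      moreover have "T x (R k x) \<gamma> \<le> T x (R (Suc k) x) \<gamma>"
        using decreasing[OF that, of x] \<gamma> \<epsilon> R by (intro T_antimono) auto
      ultimately show ?thesis using step[OF that, of x] by linarith
    qed
    then show ?thesis by (intro exI[of _ ?m]) auto
  qed
  have "\<forall>x. R 1 x = \<rho>" by (simp add: R_def)
  then show ?thesis
    unfolding first_time_sensitive_def
    using homeo half_expansivity_constant_is_sensitivity_constant R(1) decreasing limit times
    by (intro conjI exI[of _ \<epsilon>] exI[of _ R] exI[of _ \<rho>]) (auto simp: \<epsilon>_def)
qed

end

theorem theorem3p4:
  fixes f :: "'a::metric_space \<Rightarrow> 'a"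
  assumes "compact (UNIV :: 'a set)"
    and "connected (UNIV :: 'a set)"
    and "\<nexists>a. (UNIV :: 'a set) = {a}"
    and P1: "small_balls_connected TYPE('a)"
    and P2: "closed_balls_continuous TYPE('a)"
    and "cw_expansive f"
  shows "first_time_sensitive f"
proof -
  obtain r :: real where "0 < r" and "\<forall>s. 0 < s \<and> s < r \<longrightarrow> (\<forall>x :: 'a. connected (ball x s))"
    using P1 unfolding small_balls_connected_def by (elim exE conjE)
  then have r: "0 < r" "\<And>s (x :: 'a). 0 < s \<Longrightarrow> s < r \<Longrightarrow> connected (ball x s)"
    by simp_all
  have "homeo f" and "\<exists>c>0. \<forall>C. nontrivial_continuum C \<longrightarrow> (\<exists>n. diameter (int_iter f n ` C) > c)"
    using assms(6) unfolding cw_expansive_def by simp_all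
  then obtain c :: real where "0 < c"
    and "\<forall>C. nontrivial_continuum C \<longrightarrow> (\<exists>n. diameter (int_iter f n ` C) > c)"
    by (elim exE conjE)
  then have c: "0 < c"
    "\<And>C. nontrivial_continuum C \<Longrightarrow> \<exists>n. diameter (int_iter f n ` C) > c"
    by simp_all
  interpret cw_system f c r
    by unfold_locales
      (fact assms(1-3) \<open>homeo f\<close> c r closure_ball_eq_cball[OF assms(1) P2])+
  show ?thesis by (rule cw_system_first_time_sensitive)
qed

end
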